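(* Let $N \geq 3$ be an odd integer and let $a_1, \ldots, a_M$ be a sequence of integers with $M \geq 4N$. Then there exists a subsequence $a_{k_1}, \ldots, a_{k_L}$ (with $1 \le k_1 < \cdots < k_L \le M$) of length $L > N$ such that the number of sub-subsequences of $a_{k_1}, \ldots, a_{k_L}$ whose sum of elements is congruent to $0$ modulo $N$ is at least $2^L/N$.
   Context: A subsequence of a finite sequence is determined by a subset of its index positions; sub-subsequences of $a_{k_1},\ldots,a_{k_L}$ are counted as subsets $S \subseteq \{1,\ldots,L\}$ of positions (so there are $2^L$ of them in total, including the empty one, whose sum is $0$), and the sum of elements of the sub-subsequence indexed by $S$ is $\sum_{j \in S} a_{k_j}$. *)

theory Defs
  imports Complex_Main "HOL-Number_Theory.Cong"
begin

end

(*
  Two copies of one residue class form a pair; from 4N terms one can extract at least 3N/2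
  disjoint pairs.  Any N integers contain a nonempty subset with sum 0 mod N, so after
  discarding fewer than N pairs the sum b(Z) of one representative from each pair is 0 mod N;
  more than N/2 pairs remain.  Subsets of the 2|Z| chosen positions correspond to pairs (A, B)
  of subsets of Z by taking A among the first copies and the complement of B among the
  second ones.  Their sum is b(A) + b(Z) - b(B), hence 0 mod N exactly if b(A) = b(B) mod N,
  and by the Cauchy-Schwarz inequality at least 4^|Z| / N pairs (A, B) collide in this way.
*)

theory Submission
  imports Defs "HOL-Analysis.Convex" "HOL-Library.Infinite_Set"
begin

lemma exists_disjoint_equal_pairs:
  assumes "finite S"
  shows "\<exists>X f. X \<subseteq> S \<and> f ` X \<subseteq> S \<and> inj_on f X \<and> f ` X \<inter> X = {} \<and>
           (\<forall>x\<in>X. g (f x) = g x) \<and> card S \<le> card (g ` S) + 2 * card X"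
  using assms
proof (induction S rule: finite_psubset_induct)
  case (psubset S)
  show ?case
  proof (cases "inj_on g S")
    case True
    then have "card S \<le> card (g ` S) + 2 * card ({} :: 'a set)"
      by (simp add: card_image)
    then show ?thesis by (intro exI[of _ "{}"]) auto
  next
    case False
    then obtain x y where xy: "x \<in> S" "y \<in> S" "x \<noteq> y" "g x = g y"
      by (auto simp: inj_on_def)
    let ?S = "S - {x, y}"
    have "?S \<subset> S" using xy by auto
    from psubset.IH[OF this] obtain X f where
      X: "X \<subseteq> ?S" "f ` X \<subseteq> ?S" "inj_on f X" "f ` X \<inter> X = {}"
        "\<forall>z\<in>X. g (f z) = g z" "card ?S \<le> card (g ` ?S) + 2 * card X"
      by blast
    have finX: "finite X" using X(1) psubset.hyps by (meson Diff_subset finite_subset)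
    \<comment> \<open>The two removed elements are accounted for by the one new pair
      \<open>(x, y)\<close>.\<close>
    have "card ?S = card S - 2" using xy psubset.hyps by (simp add: card_Diff_subset)
    moreover have "card (g ` ?S) \<le> card (g ` S)"
      using psubset.hyps by (intro card_mono) auto
    moreover have "card (insert x X) = Suc (card X)" using X(1) finX by (subst card_insert_disjoint) auto
    ultimately have card: "card S \<le> card (g ` S) + 2 * card (insert x X)" using X(6) by linarith
    have upd: "(f(x := y)) ` insert x X = insert y (f ` X)"
      using X(1) by (auto simp: image_iff)
    have "inj_on (f(x := y)) (insert x X)"
      using X(1-3) unfolding inj_on_def by (auto simp: image_subset_iff)
    moreover have "insert y (f ` X) \<inter> insert x X = {}" using X(1,2,4) xy(3) by auto
    moreover have "\<forall>z\<in>insert x X. g ((f(x := y)) z) = g z" using X(1,5) xy(4) by auto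
    moreover have "insert x X \<subseteq> S" "insert y (f ` X) \<subseteq> S" using X(1,2) xy by auto
    ultimately show ?thesis
      using card upd
      by (intro exI[of _ "insert x X"] exI[of _ "f(x := y)"] conjI) (simp_all only:)
  qed
qed

text \<open>Pigeonhole on prefix sums: for an enumeration of \<open>Y\<close>, the N + 1 prefix sums
  of lengths 0 to N take at most N residues, so two agree and the block between them sums to
  0.\<close>

lemma exists_nonempty_zero_sum:
  fixes b :: "'a \<Rightarrow> int"
  assumes "finite Y" "N > 0" "N \<le> card Y"
  shows "\<exists>Z\<subseteq>Y. Z \<noteq> {} \<and> [sum b Z = 0] (mod int N)"
proof -
  obtain e where e: "bij_betw e {0..<card Y} Y"
    using ex_bij_betw_nat_finite[OF assms(1)] by blast
  define h where "h i = (\<Sum>j<i. b (e j)) mod int N" for i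
  have "h ` {..N} \<subseteq> {0..<int N}" using assms(2) by (auto simp: h_def)
  then have "card (h ` {..N}) \<le> card {0..<int N}" by (intro card_mono) auto
  then have "\<not> inj_on h {..N}" using card_image[of h "{..N}"] by auto
  then obtain i j where ij: "i < j" "j \<le> N" "h i = h j"
    by (metis atMost_iff inj_onI linorder_neqE_nat)
  have inj: "inj_on e {i..<j}"
    using e ij assms(3) by (auto simp: bij_betw_def intro: inj_on_subset)
  have "(\<Sum>k<j. b (e k)) = (\<Sum>k<i. b (e k)) + (\<Sum>k=i..<j. b (e k))"
    using ij(1) by (simp add: lessThan_atLeast0 sum.atLeastLessThan_concat)
  moreover have "[(\<Sum>k<j. b (e k)) = (\<Sum>k<i. b (e k))] (mod int N)"
    using ij(3) by (simp add: h_def cong_def)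
  ultimately have "[(\<Sum>k=i..<j. b (e k)) = 0] (mod int N)"
    by (simp add: cong_iff_dvd_diff)
  then have "[sum b (e ` {i..<j}) = 0] (mod int N)"
    by (simp add: sum.reindex[OF inj])
  moreover have "e ` {i..<j} \<subseteq> Y" using e ij assms(3) by (auto simp: bij_betw_def)
  ultimately show ?thesis using ij(1) by (intro exI[of _ "e ` {i..<j}"]) auto
qed

text \<open>Nonempty zero-sum sets are removed one after another until fewer than \<open>N\<close>
  elements are left; the union of the removed sets is \<open>Z\<close>.\<close>

lemma exists_large_zero_sum:
  fixes b :: "'a \<Rightarrow> int"
  assumes "finite X" "N > 0"
  shows "\<exists>Z\<subseteq>X. [sum b Z = 0] (mod int N) \<and> card X < N + card Z"
  using assms(1)
proof (induction X rule: finite_psubset_induct)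
  case (psubset X)
  show ?case
  proof (cases "card X < N")
    case True
    then show ?thesis by (intro exI[of _ "{}"]) auto
  next
    case False
    then obtain W where W: "W \<subseteq> X" "W \<noteq> {}" "[sum b W = 0] (mod int N)"
      using exists_nonempty_zero_sum[of X N b] psubset.hyps assms(2) by auto
    then obtain Z where Z: "Z \<subseteq> X - W" "[sum b Z = 0] (mod int N)" "card (X - W) < N + card Z"
      using psubset.IH[of "X - W"] by auto
    have fin: "finite W" "finite Z" using W Z psubset.hyps by (auto intro: finite_subset)
    have disj: "W \<inter> Z = {}" using Z by auto
    have "[sum b (W \<union> Z) = 0] (mod int N)"
      using cong_add[OF W(3) Z(2)] by (simp add: sum.union_disjoint fin disj)
    moreover have "card X < N + card (W \<union> Z)"
      using Z(3) W(1) fin disj card_mono[OF psubset.hyps W(1)]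
      by (simp add: card_Diff_subset card_Un_disjoint)
    ultimately show ?thesis using W Z by (intro exI[of _ "W \<union> Z"]) auto
  qed
qed

text \<open>The collisions number \<Sum> n_r^2, where n_r is the size of the fibre of
  \<open>h\<close> over r, while \<open>card P\<close> is \<Sum> n_r; Cauchy-Schwarz compares the
  two.\<close>

lemma card_square_le_card_collisions:
  assumes "finite P" "finite R" "h ` P \<subseteq> R"
  shows "(card P)\<^sup>2 \<le> card R * card {(A, B) \<in> P \<times> P. h A = h B}"
proof -
  let ?F = "\<lambda>r. {A \<in> P. h A = r}"
  have "{(A, B) \<in> P \<times> P. h A = h B} = (\<Union>r\<in>R. ?F r \<times> ?F r)" using assms(3) by auto
  then have "card {(A, B) \<in> P \<times> P. h A = h B} = (\<Sum>r\<in>R. card (?F r \<times> ?F r))"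
    using assms by (simp only:) (subst card_UN_disjoint; auto)
  then have coll: "real (card {(A, B) \<in> P \<times> P. h A = h B}) = (\<Sum>r\<in>R. (real (card (?F r)))\<^sup>2)"
    by (simp add: card_cartesian_product power2_eq_square)
  have "P = (\<Union>r\<in>R. ?F r)" using assms(3) by auto
  then have "card P = (\<Sum>r\<in>R. card (?F r))"
    using assms card_UN_disjoint[of R ?F] by auto
  then have "(real (card P))\<^sup>2 = (\<Sum>r\<in>R. real (card (?F r)))\<^sup>2" by simp
  also have "\<dots> \<le> real (card R) * (\<Sum>r\<in>R. (real (card (?F r)))\<^sup>2)"
    using sum_squared_le_sum_of_squares[of "\<lambda>r. real (card (?F r))" R]
    by (simp add: mult.commute)
  finally have "real ((card P)\<^sup>2) \<le> real (card R * card {(A, B) \<in> P \<times> P. h A = h B})"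
    by (simp only: coll of_nat_mult of_nat_power)
  then show ?thesis by linarith
qed

text \<open>Pairs of subsets of \<open>Z\<close> with congruent sums inject into the zero-sum
  subsets through \<open>?\<phi>\<close>. Since sums take at most \<open>N\<close> residues, the
  collision bound applies to these pairs.\<close>

lemma card_zero_sum_subsets_of_pairs:
  fixes a :: "'a \<Rightarrow> int"
  assumes "finite Z" "N > 0" and inj: "inj_on f Z" and disj: "f ` Z \<inter> Z = {}"
    and same: "\<And>z. z \<in> Z \<Longrightarrow> [a (f z) = a z] (mod int N)"
    and zero: "[sum a Z = 0] (mod int N)"
  shows "4 ^ card Z \<le> N * card {S. S \<subseteq> Z \<union> f ` Z \<and> [sum a S = 0] (mod int N)}"
proof -
  let ?h = "\<lambda>A. sum a A mod int N"
  let ?C = "{(A, B) \<in> Pow Z \<times> Pow Z. ?h A = ?h B}"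
  let ?T = "{S. S \<subseteq> Z \<union> f ` Z \<and> [sum a S = 0] (mod int N)}"
  let ?\<phi> = "\<lambda>(A, B). A \<union> f ` (Z - B)"
  have "(4::nat) ^ card Z = (card (Pow Z))\<^sup>2"
    using assms(1) by (simp add: card_Pow power2_eq_square flip: power_mult_distrib)
  also have "\<dots> \<le> card {0..<int N} * card ?C"
    using assms(1,2) by (intro card_square_le_card_collisions) auto
  also have "card {0..<int N} = N" by simp
  also have "card ?C \<le> card ?T"
  proof (rule card_inj_on_le)
    show "finite ?T" using assms(1) by simp
    show "inj_on ?\<phi> ?C"
    \<comment> \<open>Decoding: A is the part of S among the first copies, and B consists of the z
      whose second copy is missing from S.\<close>
    proof (rule inj_on_inverseI[where g = "\<lambda>S. (S \<inter> Z, Z - {z. f z \<in> S})"])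
      fix p assume "p \<in> ?C"
      then obtain A B where p: "p = (A, B)" "A \<subseteq> Z" "B \<subseteq> Z" by auto
      have "(A \<union> f ` (Z - B)) \<inter> Z = A" using p disj by auto
      moreover have "Z - {z. f z \<in> A \<union> f ` (Z - B)} = B"
        using p disj inj by (auto simp: inj_on_def)
      ultimately show "(?\<phi> p \<inter> Z, Z - {z. f z \<in> ?\<phi> p}) = p" by (simp add: p)
    qed
    show "?\<phi> ` ?C \<subseteq> ?T"
    proof (clarsimp, intro conjI)
      fix A B assume AB: "A \<subseteq> Z" "B \<subseteq> Z" "?h A = ?h B"
      show "A \<subseteq> Z \<union> f ` Z" "f ` (Z - B) \<subseteq> Z \<union> f ` Z" using AB by auto
      have fin: "finite A" "finite B" using AB assms(1) by (auto intro: finite_subset)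
      have "sum a (A \<union> f ` (Z - B)) = sum a A + sum a (f ` (Z - B))"
        using fin assms(1) AB disj by (intro sum.union_disjoint) auto
      also have "sum a (f ` (Z - B)) = (\<Sum>z\<in>Z - B. a (f z))"
        using inj by (subst sum.reindex) (auto intro: inj_on_subset)
      finally have eq: "sum a (A \<union> f ` (Z - B)) = sum a A + (\<Sum>z\<in>Z - B. a (f z))" .
      have "[(\<Sum>z\<in>Z - B. a (f z)) = sum a (Z - B)] (mod int N)"
        using same by (intro cong_sum) auto
      also have "sum a (Z - B) = sum a Z - sum a B"
        using AB assms(1) by (simp add: sum_diff)
      \<comment> \<open>The total over \<open>Z\<close> vanishes, and the collision allows B to be
        replaced by A, so the contribution of A cancels.\<close>
      also have "[sum a Z - sum a B = 0 - sum a A] (mod int N)"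
        using AB(3) by (intro cong_diff zero) (simp add: cong_def)
      finally show "[sum a (A \<union> f ` (Z - B)) = 0] (mod int N)"
        unfolding eq by (simp add: cong_iff_dvd_diff add.commute)
    qed
  qed
  finally show ?thesis by simp
qed

lemma exists_strict_mono_enumeration:
  fixes J :: "nat set"
  assumes "finite J"
  obtains k where "strict_mono_on {1..card J} k" "bij_betw k {1..card J} J"
proof -
  obtain h where h: "bij_betw h {..<card J} J" "strict_mono_on {..<card J} h"
    using ex_bij_betw_strict_mono_card[OF assms] by blast
  \<comment> \<open>Shift of the enumeration from indices starting at 0 to indices starting at
    1.\<close>
  have "bij_betw (\<lambda>i. i - 1) {1..card J} {..<card J}"
    by (rule bij_betwI[where g = Suc]) auto
  from bij_betw_trans[OF this h(1)] have "bij_betw (\<lambda>i. h (i - 1)) {1..card J} J"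
    by (simp add: comp_def)
  moreover have "strict_mono_on {1..card J} (\<lambda>i. h (i - 1))"
    by (intro strict_mono_onI strict_mono_onD[OF h(2)]) auto
  ultimately show ?thesis using that by blast
qed

theorem theorem1:
  fixes N M :: nat and a :: "nat \<Rightarrow> int"
  assumes "N \<ge> 3" and "odd N" and "M \<ge> 4 * N"
  shows "\<exists>(L :: nat) (k :: nat \<Rightarrow> nat).
           L > N \<and> strict_mono_on {1..L} k \<and> k ` {1..L} \<subseteq> {1..M} \<and>
           real (card {S. S \<subseteq> {1..L} \<and> [(\<Sum>j\<in>S. a (k j)) = 0] (mod int N)}) \<ge> 2 ^ L / real N"
proof -
  have N: "N > 0" using assms(1) by simp
  obtain X f where X: "X \<subseteq> {1..M}" "f ` X \<subseteq> {1..M}" "inj_on f X" "f ` X \<inter> X = {}"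
      "\<forall>x\<in>X. a (f x) mod int N = a x mod int N"
      "card {1..M} \<le> card ((\<lambda>i. a i mod int N) ` {1..M}) + 2 * card X"
    using exists_disjoint_equal_pairs[of "{1..M}" "\<lambda>i. a i mod int N"] by auto
  have "card ((\<lambda>i. a i mod int N) ` {1..M}) \<le> card {0..<int N}"
    using N by (intro card_mono) auto
  \<comment> \<open>At most N of the at least 4N indices stay unpaired, one for each
    residue.\<close>
  then have cardX: "3 * N \<le> 2 * card X" using X(6) assms(3) by simp
  have "finite X" using X(1) finite_subset by blast
  then obtain Z where Z: "Z \<subseteq> X" "[sum a Z = 0] (mod int N)" "card X < N + card Z"
    using exists_large_zero_sum[of X N a] N by auto
  have finZ: "finite Z" using Z(1) \<open>finite X\<close> finite_subset by blast
  have inj: "inj_on f Z" using X(3) Z(1) inj_on_subset by blast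
  have disj: "f ` Z \<inter> Z = {}" using X(4) Z(1) by auto
  let ?J = "Z \<union> f ` Z"
  have "?J \<subseteq> {1..M}" using X(1,2) Z(1) by blast
  have cardJ: "card ?J = 2 * card Z"
    using finZ disj by (subst card_Un_disjoint) (auto simp: card_image[OF inj])
  obtain k where k: "strict_mono_on {1..card ?J} k" "bij_betw k {1..card ?J} ?J"
    using exists_strict_mono_enumeration[of ?J] finZ by auto
  let ?T = "{S. S \<subseteq> {1..card ?J} \<and> [(\<Sum>j\<in>S. a (k j)) = 0] (mod int N)}"
  \<comment> \<open>The count over subsets of \<open>?J\<close> is transferred to subsets of
    positions: each zero-sum subset of \<open>?J\<close> is the \<open>k\<close>-image of a zero-sum
    set of positions.\<close>
  have "{S. S \<subseteq> ?J \<and> [sum a S = 0] (mod int N)} \<subseteq> (`) k ` ?T"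
  proof clarify
    fix S assume S: "S \<subseteq> ?J" "[sum a S = 0] (mod int N)"
    then obtain U where U: "U \<subseteq> {1..card ?J}" "S = k ` U"
      using k(2) by (metis bij_betw_def subset_imageE)
    have "sum a S = (\<Sum>j\<in>U. a (k j))"
      unfolding U(2) using k(2) U(1)
      by (subst sum.reindex) (auto simp: bij_betw_def intro: inj_on_subset)
    then show "S \<in> (`) k ` ?T" using S U by auto
  qed
  then have "card {S. S \<subseteq> ?J \<and> [sum a S = 0] (mod int N)} \<le> card ?T"
    by (rule surj_card_le[rotated]) simp
  moreover have "4 ^ card Z \<le> N * card {S. S \<subseteq> ?J \<and> [sum a S = 0] (mod int N)}"
    using X(5) Z by (intro card_zero_sum_subsets_of_pairs finZ N inj disj) (auto simp: cong_def)
  ultimately have "4 ^ card Z \<le> N * card ?T"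
    by (meson le_trans mult_le_mono2)
  then have "real (2 ^ card ?J) \<le> real (N * card ?T)"
    by (simp only: of_nat_le_iff cardJ) (simp add: power_mult)
  then have "2 ^ card ?J / real N \<le> real (card ?T)"
    using N by (simp add: field_simps)
  \<comment> \<open>L = 2|Z| > 2|X| - 2N \<ge> 3N - 2N = N.\<close>
  moreover have "card ?J > N" using cardX Z(3) cardJ by linarith
  moreover have "k ` {1..card ?J} \<subseteq> {1..M}"
    using k(2) \<open>?J \<subseteq> {1..M}\<close> by (simp add: bij_betw_def)
  ultimately show ?thesis using k(1) by blast
qed

end
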